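(* Let $f:I\subseteq\mathbb{R}\to\mathbb{R}$ be a differentiable mapping on $I^{\circ}$ such that $f'\in L[a,b]$, where $a,b\in I^{\circ}$ with $a<b$. If $|f'|^{q}$ is a $P$-function on $[a,b]$, $q>1$, and $\frac1p+\frac1q=1$, then $$\left|\frac{f(a)+f(b)}{2}-\frac{1}{b-a}\int_{a}^{b}f(x)\,dx\right|\leq\frac{b-a}{4}\left(\frac{1}{p+1}\right)^{\frac1p}\left\{\left(\left|f'\left(\tfrac{a+b}{2}\right)\right|^{q}+|f'(a)|^{q}\right)^{\frac1q}+\left(\left|f'\left(\tfrac{a+b}{2}\right)\right|^{q}+|f'(b)|^{q}\right)^{\frac1q}\right\}.$$
   Context: $I$ is an interval of real numbers and $I^{\circ}$ is its interior. $L[a,b]$ denotes the integrable functions on $[a,b]$. A function $g:J\to\mathbb{R}$ on an interval $J$ is a $P$-function if $g$ is non-negative and $g(tx+(1-t)y)\leq g(x)+g(y)$ for all $x,y\in J$ and $t\in[0,1]$. *)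

theory Defs
  imports "HOL-Analysis.Analysis"
begin

definition P_function_on :: "real set \<Rightarrow> (real \<Rightarrow> real) \<Rightarrow> bool" where
  "P_function_on J g \<longleftrightarrow>
     is_interval J \<and>
     (\<forall>x\<in>J. 0 \<le> g x) \<and>
     (\<forall>x\<in>J. \<forall>y\<in>J. \<forall>t\<in>{0..1}. g (t * x + (1 - t) * y) \<le> g x + g y)"

end

theory Submission
  imports Defs
begin

text \<open>
  A P-function on an interval is bounded there by the sum of its values at the two endpoints
  (\<open>P_function_on_le_endpoints\<close>). With \<open>m\<close> the midpoint of \<open>[a, b]\<close>, applying this to
  \<open>\<bar>f'\<bar>\<^sup>q\<close> on each half gives the pointwise bounds \<open>\<bar>f'\<bar> \<le> A\<close> on \<open>[a, m]\<close> and \<open>\<bar>f'\<bar> \<le> B\<close> on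
  \<open>[m, b]\<close>, where \<open>A\<close> and \<open>B\<close> are the two \<open>q\<close>-th roots on the right-hand side of the claim.

  The trapezoid error splits as
  \<open>(1/(b - a)) (\<integral>\<^sub>a\<^sup>m (f a - f x) dx + \<integral>\<^sub>m\<^sup>b (f b - f x) dx)\<close>. By the mean value
  theorem the integrands are at most \<open>A (x - a)\<close> and \<open>B (b - x)\<close> in absolute value, so the error
  is at most \<open>(b - a) (A + B) / 8\<close> (\<open>trapezoid_error_le\<close>). This implies the claim, since
  \<open>1/2 \<le> (1/(p + 1)) powr (1/p)\<close>, which is \<open>1 + p \<le> 2 powr p\<close>, holds for every \<open>p \<ge> 1\<close>
  (\<open>half_le_powr_inverse\<close>).
\<close>

lemma P_function_on_le_endpoints:
  assumes g: "P_function_on J g" and "u \<in> J" "v \<in> J" "x \<in> {u..v}"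
  shows "g x \<le> g u + g v"
proof -
  have "x \<in> closed_segment u v"
    using assms(4) by (auto simp: closed_segment_eq_real_ivl)
  then obtain s where "0 \<le> s" "s \<le> 1" and x: "x = (1 - s) * u + s * v"
    by (auto simp: closed_segment_def)
  then have "1 - s \<in> {0..1}" and "x = (1 - s) * u + (1 - (1 - s)) * v"
    by auto
  then show ?thesis
    using g assms(2,3) unfolding P_function_on_def by metis
qed

lemma abs_le_powr_inverse_of_powr_le:
  fixes y C q :: real
  assumes "\<bar>y\<bar> powr q \<le> C" and "q > 0"
  shows "\<bar>y\<bar> \<le> C powr (1 / q)"
proof -
  have "\<bar>y\<bar> = (\<bar>y\<bar> powr q) powr (1 / q)"
    using assms(2) by (simp add: powr_powr)
  also have "\<dots> \<le> C powr (1 / q)"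
    using assms by (intro powr_mono2) auto
  finally show ?thesis .
qed

text \<open>
  After taking logarithms this says \<open>ln (1 + p) \<le> p ln 2\<close>. The tangent of \<open>ln (1 + p)\<close> at
  \<open>p = 1\<close>, where equality holds, has slope \<open>1/2 < ln 2\<close>, and concavity does the rest.
\<close>

lemma half_le_powr_inverse:
  fixes p :: real
  assumes "p \<ge> 1"
  shows "1 / 2 \<le> (1 / (p + 1)) powr (1 / p)"
proof -
  have "ln (p + 1) = ln 2 + ln ((p + 1) / 2)"
    using assms by (simp add: ln_div)
  also have "\<dots> \<le> ln 2 + ((p + 1) / 2 - 1)"
    using assms ln_le_minus_one[of "(p + 1) / 2"] by simp
  also have "\<dots> = ln 2 + (p - 1) * (1 / 2)"
    by (simp add: field_simps)
  also have "\<dots> \<le> ln 2 + (p - 1) * ln 2"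
    using assms ln2_ge_two_thirds by (intro add_left_mono mult_left_mono) auto
  finally have "ln (p + 1) \<le> p * ln 2"
    by (simp add: algebra_simps)
  then have "- ln 2 \<le> 1 / p * ln (1 / (p + 1))"
    using assms by (simp add: ln_div field_simps)
  then have "exp (- ln 2) \<le> exp (1 / p * ln (1 / (p + 1)))"
    by simp
  then show ?thesis
    using assms by (simp add: powr_def exp_minus)
qed

text \<open>
  The half-interval estimate. The comparison point \<open>c\<close> may be either endpoint, which makes the
  two halves of the trapezoid error instances of the same bound: in both cases the distance to
  \<open>c\<close> integrates to \<open>(v - u)\<^sup>2 / 2\<close>.
\<close>

lemma abs_integral_diff_endpoint_le:
  fixes f f' :: "real \<Rightarrow> real"
  assumes "u \<le> v" and c: "c = u \<or> c = v"
    and der: "\<And>x. x \<in> {u..v} \<Longrightarrow> (f has_real_derivative f' x) (at x within {u..v})"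
    and bound: "\<And>x. x \<in> {u..v} \<Longrightarrow> \<bar>f' x\<bar> \<le> M"
  shows "\<bar>integral {u..v} (\<lambda>x. f c - f x)\<bar> \<le> M * ((v - u)\<^sup>2 / 2)"
proof -
  have cont: "continuous_on {u..v} f"
    using der by (rule DERIV_continuous_on)
  have dist: "((\<lambda>x. \<bar>c - x\<bar>) has_integral (v - u)\<^sup>2 / 2) {u..v}"
    using c
  proof
    assume "c = u"
    have "((\<lambda>x. x - u) has_integral (v - u)\<^sup>2 / 2 - (u - u)\<^sup>2 / 2) {u..v}"
      using \<open>u \<le> v\<close>
      by (intro fundamental_theorem_of_calculus)
        (auto intro!: derivative_eq_intros
          simp: has_real_derivative_iff_has_vector_derivative[symmetric])
    then show ?thesis
      using \<open>c = u\<close> by (auto intro: has_integral_eq[rotated])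
  next
    assume "c = v"
    have "((\<lambda>x. v - x) has_integral - (v - v)\<^sup>2 / 2 - - (v - u)\<^sup>2 / 2) {u..v}"
      using \<open>u \<le> v\<close>
      by (intro fundamental_theorem_of_calculus)
        (auto intro!: derivative_eq_intros
          simp: field_simps has_real_derivative_iff_has_vector_derivative[symmetric])
    then show ?thesis
      using \<open>c = v\<close> by (auto intro: has_integral_eq[rotated])
  qed
  have "norm (integral {u..v} (\<lambda>x. f c - f x)) \<le> integral {u..v} (\<lambda>x. M * \<bar>c - x\<bar>)"
  proof (rule integral_norm_bound_integral)
    show "(\<lambda>x. f c - f x) integrable_on {u..v}"
      by (intro integrable_continuous_interval continuous_intros cont)
    show "(\<lambda>x. M * \<bar>c - x\<bar>) integrable_on {u..v}"
      by (intro integrable_continuous_interval continuous_intros)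
    show "norm (f c - f x) \<le> M * \<bar>c - x\<bar>" if "x \<in> {u..v}" for x
      using field_differentiable_bound[of "{u..v}" f f' M c x] der bound that c \<open>u \<le> v\<close>
      by auto
  qed
  also have "\<dots> = M * ((v - u)\<^sup>2 / 2)"
    using has_integral_mult_right[OF dist] by (rule integral_unique)
  finally show ?thesis
    by simp
qed

lemma trapezoid_error_le:
  fixes f f' :: "real \<Rightarrow> real"
  assumes "a < b"
    and der: "\<And>x. x \<in> {a..b} \<Longrightarrow> (f has_real_derivative f' x) (at x within {a..b})"
    and left: "\<And>x. x \<in> {a..(a + b) / 2} \<Longrightarrow> \<bar>f' x\<bar> \<le> A"
    and right: "\<And>x. x \<in> {(a + b) / 2..b} \<Longrightarrow> \<bar>f' x\<bar> \<le> B"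
  shows "\<bar>(f a + f b) / 2 - 1 / (b - a) * integral {a..b} f\<bar> \<le> (b - a) / 8 * (A + B)"
proof -
  define m where "m = (a + b) / 2"
  have m: "a \<le> m" "m \<le> b" "m - a = (b - a) / 2" "b - m = (b - a) / 2"
    using \<open>a < b\<close> by (auto simp: m_def field_simps)
  have "continuous_on {a..b} f"
    using der by (rule DERIV_continuous_on)
  then have int: "f integrable_on {a..b}"
    by (rule integrable_continuous_interval)
  then have int_l: "f integrable_on {a..m}" and int_r: "f integrable_on {m..b}"
    using m by (auto intro: integrable_subinterval_real)
  define L where "L = integral {a..m} (\<lambda>x. f a - f x)"
  define R where "R = integral {m..b} (\<lambda>x. f b - f x)"
  have "L = (b - a) / 2 * f a - integral {a..m} f"
    unfolding L_def using int_l m by (subst integral_diff) auto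
  moreover have "R = (b - a) / 2 * f b - integral {m..b} f"
    unfolding R_def using int_r m by (subst integral_diff) auto
  moreover have "integral {a..m} f + integral {m..b} f = integral {a..b} f"
    using m int by (intro Henstock_Kurzweil_Integration.integral_combine) auto
  ultimately have "L + R = (b - a) * ((f a + f b) / 2) - integral {a..b} f"
    by (simp add: field_simps)
  then have error: "(f a + f b) / 2 - 1 / (b - a) * integral {a..b} f = (L + R) / (b - a)"
    using \<open>a < b\<close> by (simp add: diff_divide_distrib del: times_divide_eq_right)
  have "\<bar>L\<bar> \<le> A * ((m - a)\<^sup>2 / 2)"
    unfolding L_def using m left
    by (intro abs_integral_diff_endpoint_le[where f' = f'])
      (auto simp: m_def[symmetric] intro: DERIV_subset[OF der])
  moreover have "\<bar>R\<bar> \<le> B * ((b - m)\<^sup>2 / 2)"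
    unfolding R_def using m right
    by (intro abs_integral_diff_endpoint_le[where f' = f'])
      (auto simp: m_def[symmetric] intro: DERIV_subset[OF der])
  ultimately have "\<bar>L + R\<bar> \<le> (b - a) / 8 * (A + B) * (b - a)"
    using abs_triangle_ineq[of L R] unfolding m
    by (simp add: power2_eq_square field_simps)
  then show ?thesis
    unfolding error using \<open>a < b\<close> by (simp add: pos_divide_le_eq)
qed

theorem corollary7:
  fixes f :: "real \<Rightarrow> real" and I :: "real set" and a b p q :: real
  assumes "is_interval I"
    and "f differentiable_on interior I"
    and "a \<in> interior I" and "b \<in> interior I" and "a < b"
    and "set_integrable lebesgue {a..b} (deriv f)"
    and "P_function_on {a..b} (\<lambda>x. \<bar>deriv f x\<bar> powr q)"
    and "q > 1" and "1 / p + 1 / q = 1"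
  shows "\<bar>(f a + f b) / 2 - 1 / (b - a) * integral {a..b} f\<bar>
    \<le> (b - a) / 4 * (1 / (p + 1)) powr (1 / p) *
      ((\<bar>deriv f ((a + b) / 2)\<bar> powr q + \<bar>deriv f a\<bar> powr q) powr (1 / q) +
       (\<bar>deriv f ((a + b) / 2)\<bar> powr q + \<bar>deriv f b\<bar> powr q) powr (1 / q))"
proof -
  define A where "A = (\<bar>deriv f ((a + b) / 2)\<bar> powr q + \<bar>deriv f a\<bar> powr q) powr (1 / q)"
  define B where "B = (\<bar>deriv f ((a + b) / 2)\<bar> powr q + \<bar>deriv f b\<bar> powr q) powr (1 / q)"
  have "is_interval (interior I)"
    using assms(1) by (simp add: is_interval_convex_1)
  then have sub: "{a..b} \<subseteq> interior I"
    using assms(3,4) interval_subset_is_interval[of "interior I" a b] by simp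
  have der: "(f has_real_derivative deriv f x) (at x within {a..b})" if "x \<in> {a..b}" for x
  proof -
    have "f differentiable (at x)"
      using assms(2) subsetD[OF sub that]
      by (simp add: differentiable_on_eq_differentiable_at)
    then show ?thesis
      by (simp add: DERIV_deriv_iff_real_differentiable has_field_derivative_at_within)
  qed
  have left: "\<bar>deriv f x\<bar> \<le> A" if "x \<in> {a..(a + b) / 2}" for x
    unfolding A_def
    using P_function_on_le_endpoints[OF assms(7), of a "(a + b) / 2" x] that \<open>a < b\<close> \<open>q > 1\<close>
    by (intro abs_le_powr_inverse_of_powr_le) auto
  have right: "\<bar>deriv f x\<bar> \<le> B" if "x \<in> {(a + b) / 2..b}" for x
    unfolding B_def
    using P_function_on_le_endpoints[OF assms(7), of "(a + b) / 2" b x] that \<open>a < b\<close> \<open>q > 1\<close>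
    by (intro abs_le_powr_inverse_of_powr_le) auto
  have "1 / p = 1 - 1 / q"
    using assms(9) by simp
  moreover have "0 < 1 - 1 / q" "1 - 1 / q \<le> 1"
    using \<open>q > 1\<close> by (simp_all add: field_simps)
  ultimately have "0 < 1 / p" "1 / p \<le> 1"
    by simp_all
  then have "p \<ge> 1"
    by (simp add: divide_le_eq_1)
  have "\<bar>(f a + f b) / 2 - 1 / (b - a) * integral {a..b} f\<bar> \<le> (b - a) / 8 * (A + B)"
    using \<open>a < b\<close> der left right by (rule trapezoid_error_le)
  also have "\<dots> = (b - a) / 4 * (1 / 2) * (A + B)"
    by simp
  also have "\<dots> \<le> (b - a) / 4 * (1 / (p + 1)) powr (1 / p) * (A + B)"
    using half_le_powr_inverse[OF \<open>p \<ge> 1\<close>] \<open>a < b\<close>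
    by (intro mult_right_mono mult_left_mono) (auto simp: A_def B_def)
  finally show ?thesis
    unfolding A_def B_def .
qed

end
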